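(* Let $k\ge 2$, let $\Sigma$ be a finite non-empty alphabet, and let $G=dB_\Sigma(k-1)$ be the de Bruijn graph of order $k-1$. Then $s_{\max}$, the maximal number $s$ of runs in a run factorization of a $k$-abelian singleton over $\Sigma$, is bounded above by the largest $s$ for which there exists a set $C=\{C_1,\ldots,C_s\}$ of $s$ vertex-disjoint cycles of $G$ such that the quotient graph $G/C$ contains a path which traverses each vertex $V_i$ ($1\le i\le s$) precisely once and each vertex $\{v\}$, $v\in V_\otimes$, at most twice.
   Context: Two words are $k$-abelian equivalent if each non-empty word of length at most $k$ occurs equally many times (overlaps counted) as a factor in both; $u$ is a $k$-abelian singleton if no other word is $k$-abelian equivalent to $u$. For a non-empty word $r$ and rational $q$ with $q|r|\in\mathbb{N}$, $r^q$ is the prefix of length $q|r|$ of $r^\omega=rrr\cdots$; for $q\ge2$ it is called a repetition. $F_{k-1}(r^\circ)$ is the set of factors of length $k-1$ of $r^\omega$. A word $r$ is $k$-full if $|F_{k-1}(r^\circ)|=|r|$; a $k$-full repetition is a repetition of a $k$-full word that contains some factor of length $k-1$ at least three times. A run in $u=a_1\cdots a_n$ is an occurrence $a_i\cdots a_{m-1}=r^q$, $r$ primitive, $q\ge2$, which cannot be extended, i.e. ($i=1$ or $a_{i-1}\ne a_{i-1+|r|}$) and ($m-1=n$ or $a_m\ne a_{m-|r|}$). A $k$-full run is a run that is a $k$-full repetition. Run factorization of a $k$-abelian singleton $u$: an expression $u=t_0\cdot r_1^{q_1}\cdot[t_1]^{\sigma_1}\cdot r_2^{q_2}\cdots[t_{s-1}]^{\sigma_{s-1}}\cdot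 r_s^{q_s}\cdot t_s$ (with $u=t_0$ if $s=0$), where $t_i\in\Sigma^*$, $\sigma_i\in\{+1,-1\}$, each $r_i^{q_i}$ is a $k$-full run of $u$ with $q_i\ge 2+\frac{k-1}{|r_i|}$, the sets $F_{k-1}(r_i^\circ)$ are pairwise disjoint, and (with $\sigma_0=\sigma_s=+1$) if $\sigma_i=+1$ (resp. $-1$) then any factor of length $k-1$ overlapping $t_i$ (resp. containing $t_i$ strictly inside, i.e. with at least one letter on both sides) occurs at most twice in $u$. Here $[t_i]^{+1}$ means that the word $t_i$ stands between the consecutive runs, and $[t_i]^{-1}$ means that the two consecutive runs overlap in the word $t_i$, of length at most $k-2$. A factor overlaps $t_i$ if its occurrence shares a position with the occurrence of $t_i$, or, if $t_i$ is empty, if it straddles the boundary. $s_{\max}$ is the maximum of $s$ over all such factorizations of all $k$-abelian singletons over $\Sigma$ of any length. $dB_\Sigma(n)$ has vertex set $\Sigma^n$, with an edge from $p$ to $q$ if and only if $p=ax$, $q=xb$ for some $a,b\in\Sigma$, $x\in\Sigma^{n-1}$. Cycles are directed cycles without repeated vertices (loops are cycles of length 1). For a graph $G=(V,E)$ and a set $C=\{C_1,\ldots,C_s\}$ of vertex-disjoint cycles of $G$, let $V_i$ be the set of vertices of $C_i$ and $V_\otimes=V\setminus\bigcup_i V_i$. Let $V/C$ be the partition of $V$ consisting of the $V_i$ and the singletons $\{v\}$, $v\in V_\otimes$. The quotient graph $G/C$ has vertex set $V/C$ and, for $X\ne Y$ in $V/C$, an edge $(X,Y)$ if and only if $(x,y)\in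 E$ for some $x\in X$, $y\in Y$. "Path" here means a directed walk (vertices may be repeated, subject to the stated restrictions). *)

theory Defs
  imports Complex_Main "Graph_Theory.Pair_Digraph" "Graph_Theory.Vertex_Walk"
begin

section \<open>Words and \<open>k\<close>-abelian equivalence\<close>

text \<open>
  Words over \<open>\<Sigma>\<close> are the elements of \<^term>\<open>lists \<Sigma>\<close>. Positions are counted from 0, and the
  occurrence of a word \<open>w\<close> at position \<open>i\<close> occupies the positions \<open>i, \<dots>, i + length w - 1\<close>.
\<close>

definition occurs_at :: "'a list \<Rightarrow> 'a list \<Rightarrow> nat \<Rightarrow> bool" where
  "occurs_at w u i \<longleftrightarrow> i + length w \<le> length u \<and> take (length w) (drop i u) = w"

definition occ :: "'a list \<Rightarrow> 'a list \<Rightarrow> nat" where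
  "occ w u = card {i. occurs_at w u i}"

definition k_abelian_equiv :: "nat \<Rightarrow> 'a list \<Rightarrow> 'a list \<Rightarrow> bool" where
  "k_abelian_equiv k u v \<longleftrightarrow> (\<forall>w. w \<noteq> [] \<and> length w \<le> k \<longrightarrow> occ w u = occ w v)"

definition k_abelian_singleton :: "nat \<Rightarrow> 'a set \<Rightarrow> 'a list \<Rightarrow> bool" where
  "k_abelian_singleton k \<Sigma> u \<longleftrightarrow>
     u \<in> lists \<Sigma> \<and> (\<forall>v\<in>lists \<Sigma>. k_abelian_equiv k u v \<longrightarrow> v = u)"


section \<open>Powers, repetitions and runs\<close>

text \<open>The \<open>i\<close>-th letter of \<open>r r r \<cdots>\<close> (for non-empty \<open>r\<close>).\<close>

definition omega :: "'a list \<Rightarrow> nat \<Rightarrow> 'a" where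
  "omega r i = r ! (i mod length r)"

definition admissible_exponent :: "'a list \<Rightarrow> rat \<Rightarrow> bool" where
  "admissible_exponent r q \<longleftrightarrow> r \<noteq> [] \<and> q * of_nat (length r) \<in> \<nat>"

text \<open>The rational power; meaningful only for an admissible exponent, where the floor is exact.\<close>

definition rpow :: "'a list \<Rightarrow> rat \<Rightarrow> 'a list" where
  "rpow r q = map (omega r) [0..<nat \<lfloor>q * of_nat (length r)\<rfloor>]"

definition is_repetition :: "'a list \<Rightarrow> rat \<Rightarrow> bool" where
  "is_repetition r q \<longleftrightarrow> admissible_exponent r q \<and> q \<ge> 2"

definition cyclic_factors :: "nat \<Rightarrow> 'a list \<Rightarrow> 'a list set" where
  "cyclic_factors n r = {map (omega r) [i..<i + n] | i. True}"

definition k_full :: "nat \<Rightarrow> 'a list \<Rightarrow> bool" where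
  "k_full k r \<longleftrightarrow> r \<noteq> [] \<and> card (cyclic_factors (k - 1) r) = length r"

definition k_full_repetition :: "nat \<Rightarrow> 'a list \<Rightarrow> rat \<Rightarrow> bool" where
  "k_full_repetition k r q \<longleftrightarrow>
     is_repetition r q \<and> k_full k r \<and> (\<exists>w. length w = k - 1 \<and> occ w (rpow r q) \<ge> 3)"

definition primitive :: "'a list \<Rightarrow> bool" where
  "primitive r \<longleftrightarrow> r \<noteq> [] \<and> (\<nexists>v n. n \<ge> 2 \<and> r = concat (replicate n v))"

text \<open>A run is an occurrence, hence given by its root, its exponent and its starting position.\<close>

definition is_run :: "'a list \<Rightarrow> nat \<Rightarrow> 'a list \<Rightarrow> rat \<Rightarrow> bool" where
  "is_run u b r q \<longleftrightarrow>
     primitive r \<and> is_repetition r q \<and> occurs_at (rpow r q) u b \<and>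
     (b = 0 \<or> u ! (b - 1) \<noteq> u ! (b - 1 + length r)) \<and>
     (let e = b + length (rpow r q) in e = length u \<or> u ! e \<noteq> u ! (e - length r))"

definition k_full_run :: "nat \<Rightarrow> 'a list \<Rightarrow> nat \<Rightarrow> 'a list \<Rightarrow> rat \<Rightarrow> bool" where
  "k_full_run k u b r q \<longleftrightarrow> is_run u b r q \<and> k_full_repetition k r q"


section \<open>Run factorizations\<close>

text \<open>
  The factorization \<open>t\<^sub>0 \<cdot> r\<^sub>1\<^bsup>q\<^sub>1\<^esup> \<cdot> [t\<^sub>1]\<^bsup>\<sigma>\<^sub>1\<^esup> \<cdots> r\<^sub>s\<^bsup>q\<^sub>s\<^esup> \<cdot> t\<^sub>s\<close> is given by functions \<open>t\<close>, \<open>\<sigma>\<close> (relevant on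
  \<open>0, \<dots>, s\<close>) and \<open>r\<close>, \<open>q\<close> (relevant on \<open>1, \<dots>, s\<close>). Reading it from left to right determines the
  positions of all its parts: \<open>run_end i\<close> is the first position after the \<open>i\<close>-th run (with
  \<open>run_end 0 = 0\<close>), and \<open>next_start i\<close> is the first position of the \<open>(i+1)\<close>-st run, which lies
  \<open>length t\<^sub>i\<close> after or before \<open>run_end i\<close> according to the sign. In the second case \<open>t\<^sub>i\<close> is the
  overlap of the two runs. The subtraction does not truncate in a run factorization, where the
  overlap is shorter than the preceding run.
\<close>

definition next_pos :: "int \<Rightarrow> 'a list \<Rightarrow> nat \<Rightarrow> nat" where
  "next_pos sg x e = (if sg = 1 then e + length x else e - length x)"

primrec run_end ::
  "(nat \<Rightarrow> 'a list) \<Rightarrow> (nat \<Rightarrow> int) \<Rightarrow> (nat \<Rightarrow> 'a list) \<Rightarrow> (nat \<Rightarrow> rat) \<Rightarrow> nat \<Rightarrow> nat" where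
  "run_end t \<sigma> r q 0 = 0"
| "run_end t \<sigma> r q (Suc i) =
     next_pos (\<sigma> i) (t i) (run_end t \<sigma> r q i) + length (rpow (r (Suc i)) (q (Suc i)))"

definition next_start ::
  "(nat \<Rightarrow> 'a list) \<Rightarrow> (nat \<Rightarrow> int) \<Rightarrow> (nat \<Rightarrow> 'a list) \<Rightarrow> (nat \<Rightarrow> rat) \<Rightarrow> nat \<Rightarrow> nat" where
  "next_start t \<sigma> r q i = next_pos (\<sigma> i) (t i) (run_end t \<sigma> r q i)"

definition t_pos ::
  "(nat \<Rightarrow> 'a list) \<Rightarrow> (nat \<Rightarrow> int) \<Rightarrow> (nat \<Rightarrow> 'a list) \<Rightarrow> (nat \<Rightarrow> rat) \<Rightarrow> nat \<Rightarrow> nat" where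
  "t_pos t \<sigma> r q i = (if \<sigma> i = 1 then run_end t \<sigma> r q i else next_start t \<sigma> r q i)"

text \<open>
  For the occurrences of a word of length \<open>n\<close> at \<open>j\<close> and of a word of length \<open>l\<close> at \<open>p\<close>. If \<open>l = 0\<close>,
  the first condition says that the occurrence at \<open>j\<close> has a letter on both sides of the boundary \<open>p\<close>.
\<close>

definition overlapping :: "nat \<Rightarrow> nat \<Rightarrow> nat \<Rightarrow> nat \<Rightarrow> bool" where
  "overlapping j n p l \<longleftrightarrow> j < p + l \<and> p < j + n"

definition strictly_inside :: "nat \<Rightarrow> nat \<Rightarrow> nat \<Rightarrow> nat \<Rightarrow> bool" where
  "strictly_inside j n p l \<longleftrightarrow> j < p \<and> p + l < j + n"

definition run_factorization ::
  "nat \<Rightarrow> 'a list \<Rightarrow> nat \<Rightarrow> (nat \<Rightarrow> 'a list) \<Rightarrow> (nat \<Rightarrow> int) \<Rightarrow>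
     (nat \<Rightarrow> 'a list) \<Rightarrow> (nat \<Rightarrow> rat) \<Rightarrow> bool" where
  "run_factorization k u s t \<sigma> r q \<longleftrightarrow>
     (\<forall>i\<le>s. \<sigma> i \<in> {1, -1}) \<and> \<sigma> 0 = 1 \<and> \<sigma> s = 1 \<and>
     \<comment> \<open>\<open>u\<close> is the product; the runs are matched with \<open>u\<close> by \<^const>\<open>k_full_run\<close> below\<close>
     (\<forall>i\<le>s. occurs_at (t i) u (t_pos t \<sigma> r q i)) \<and>
     length u = run_end t \<sigma> r q s + length (t s) \<and>
     (\<forall>i\<le>s. \<sigma> i = -1 \<longrightarrow> length (t i) \<le> k - 2) \<and>
     (\<forall>i\<in>{1..s}. k_full_run k u (next_start t \<sigma> r q (i - 1)) (r i) (q i) \<and>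
        q i \<ge> 2 + of_nat (k - 1) / of_nat (length (r i))) \<and>
     (\<forall>i\<in>{1..s}. \<forall>j\<in>{1..s}. i \<noteq> j \<longrightarrow>
        cyclic_factors (k - 1) (r i) \<inter> cyclic_factors (k - 1) (r j) = {}) \<and>
     (\<forall>i\<le>s. \<forall>j w. length w = k - 1 \<and> occurs_at w u j \<and>
        (if \<sigma> i = 1 then overlapping j (k - 1) (t_pos t \<sigma> r q i) (length (t i))
         else strictly_inside j (k - 1) (t_pos t \<sigma> r q i) (length (t i)))
        \<longrightarrow> occ w u \<le> 2)"

definition run_counts :: "nat \<Rightarrow> 'a set \<Rightarrow> nat set" where
  "run_counts k \<Sigma> =
     {s. \<exists>u t \<sigma> r q. k_abelian_singleton k \<Sigma> u \<and> run_factorization k u s t \<sigma> r q}"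

definition s_max :: "nat \<Rightarrow> 'a set \<Rightarrow> nat" where
  "s_max k \<Sigma> = Max (run_counts k \<Sigma>)"


section \<open>De Bruijn graphs, cycles and quotient graphs\<close>

definition de_bruijn :: "'a set \<Rightarrow> nat \<Rightarrow> 'a list pair_pre_digraph" where
  "de_bruijn \<Sigma> n =
     \<lparr> pverts = {w \<in> lists \<Sigma>. length w = n},
       parcs = {(a # x, x @ [b]) | a b x. a \<in> \<Sigma> \<and> b \<in> \<Sigma> \<and> x \<in> lists \<Sigma> \<and> Suc (length x) = n} \<rparr>"

text \<open>
  A cycle is a list of arcs in the sense of \<^const>\<open>pre_digraph.cycle\<close> (loops are allowed there);
  since it is closed, its vertices are the tails of its arcs. Two lists that are rotations of each
  other have the same vertices, so they never both belong to a set of vertex-disjoint cycles.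
\<close>

definition cycle_verts :: "('v \<times> 'v) awalk \<Rightarrow> 'v set" where
  "cycle_verts c = fst ` set c"

definition vertex_disjoint_cycles :: "'v pair_pre_digraph \<Rightarrow> ('v \<times> 'v) awalk set \<Rightarrow> bool" where
  "vertex_disjoint_cycles G C \<longleftrightarrow>
     finite C \<and> (\<forall>c\<in>C. pre_digraph.cycle (with_proj G) c) \<and>
     (\<forall>c\<in>C. \<forall>d\<in>C. c \<noteq> d \<longrightarrow> cycle_verts c \<inter> cycle_verts d = {})"

definition free_verts :: "'v pair_pre_digraph \<Rightarrow> ('v \<times> 'v) awalk set \<Rightarrow> 'v set" where
  "free_verts G C = pverts G - (\<Union>c\<in>C. cycle_verts c)"

definition quotient_verts :: "'v pair_pre_digraph \<Rightarrow> ('v \<times> 'v) awalk set \<Rightarrow> 'v set set" where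
  "quotient_verts G C = cycle_verts ` C \<union> {{v} | v. v \<in> free_verts G C}"

definition quotient_graph ::
  "'v pair_pre_digraph \<Rightarrow> ('v \<times> 'v) awalk set \<Rightarrow> 'v set pair_pre_digraph" where
  "quotient_graph G C =
     \<lparr> pverts = quotient_verts G C,
       parcs = {(X, Y). X \<in> quotient_verts G C \<and> Y \<in> quotient_verts G C \<and> X \<noteq> Y \<and>
                  (\<exists>x\<in>X. \<exists>y\<in>Y. (x, y) \<in> parcs G)} \<rparr>"

definition cycle_path_counts :: "'v pair_pre_digraph \<Rightarrow> nat set" where
  "cycle_path_counts G =
     {s. \<exists>C p. vertex_disjoint_cycles G C \<and> card C = s \<and>
           vwalk p (with_proj (quotient_graph G C)) \<and>
           (\<forall>c\<in>C. count_list p (cycle_verts c) = 1) \<and>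
           (\<forall>v\<in>free_verts G C. count_list p {v} \<le> 2)}"


section \<open>The maxima exist\<close>

lemma cyclic_factors_subset:
  assumes "r \<noteq> []" "r \<in> lists \<Sigma>"
  shows "cyclic_factors n r \<subseteq> {w \<in> lists \<Sigma>. length w = n}"
  using assms unfolding cyclic_factors_def omega_def
  by (auto simp: in_lists_conv_set)

lemma finite_words:
  assumes "finite \<Sigma>"
  shows "finite {w \<in> lists \<Sigma>. length w = n}"
  using finite_lists_length_eq[OF assms, of n] by (simp add: lists_eq_set conj_commute Collect_conj_eq Int_commute)

lemma root_in_lists:
  assumes "is_repetition r q" "occurs_at (rpow r q) u b" "u \<in> lists \<Sigma>"
  shows "r \<in> lists \<Sigma>"
proof -
  let ?m = "nat \<lfloor>q * of_nat (length r)\<rfloor>"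
  have "q * of_nat (length r) \<ge> 2 * of_nat (length r)" and ne: "r \<noteq> []"
    using assms(1) by (auto simp: is_repetition_def admissible_exponent_def intro: mult_right_mono)
  hence "\<lfloor>q * of_nat (length r)\<rfloor> \<ge> 2 * int (length r)"
    by (metis floor_mono floor_of_nat of_nat_mult of_nat_numeral)
  hence m: "length r \<le> ?m" by linarith
  have "set r \<subseteq> set (rpow r q)"
  proof
    fix x assume "x \<in> set r"
    then obtain i where "i < length r" "x = r ! i" by (metis in_set_conv_nth)
    with m show "x \<in> set (rpow r q)"
      by (auto simp: rpow_def omega_def intro!: image_eqI[of _ _ i])
  qed
  also have "\<dots> \<subseteq> set u"
    using assms(2) unfolding occurs_at_def by (metis set_take_subset set_drop_subset subset_trans)
  finally show ?thesis using assms(3) by auto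
qed

lemma finite_run_counts:
  assumes "finite \<Sigma>"
  shows "finite (run_counts k \<Sigma>)"
proof -
  let ?W = "{w \<in> lists \<Sigma>. length w = k - 1}"
  have "s \<le> card (Pow ?W)" if "s \<in> run_counts k \<Sigma>" for s
  proof -
    from that obtain u t \<sigma> r q where sing: "k_abelian_singleton k \<Sigma> u"
      and rf: "run_factorization k u s t \<sigma> r q"
      unfolding run_counts_def by blast
    let ?F = "\<lambda>i. cyclic_factors (k - 1) (r i)"
    have run: "k_full_run k u (next_start t \<sigma> r q (i - 1)) (r i) (q i)" if "i \<in> {1..s}" for i
      using rf that unfolding run_factorization_def by blast
    have ne: "?F i \<noteq> {}" for i by (auto simp: cyclic_factors_def)
    have "inj_on ?F {1..s}"
    proof (rule inj_onI, rule ccontr)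
      fix i j assume ij: "i \<in> {1..s}" "j \<in> {1..s}" and eq: "?F i = ?F j" and "i \<noteq> j"
      hence "?F i \<inter> ?F j = {}" using rf unfolding run_factorization_def by blast
      with eq ne show False by auto
    qed
    moreover have "?F ` {1..s} \<subseteq> Pow ?W"
    proof -
      have "?F i \<subseteq> ?W" if "i \<in> {1..s}" for i
      proof (rule cyclic_factors_subset)
        show "r i \<noteq> []" using run[OF that]
          by (auto simp: k_full_run_def is_run_def primitive_def)
        show "r i \<in> lists \<Sigma>"
          by (rule root_in_lists[of _ "q i" u]) 
            (use run[OF that] sing in \<open>auto simp: k_full_run_def is_run_def k_abelian_singleton_def\<close>)
      qed
      thus ?thesis by blast
    qed
    ultimately have "card {1..s} \<le> card (Pow ?W)"
      using finite_words[OF assms] by (intro card_inj_on_le[of ?F]) auto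
    thus ?thesis by simp
  qed
  thus ?thesis by (meson finite_nat_set_iff_bounded_le)
qed

lemma zero_in_run_counts:
  assumes "k \<ge> 2"
  shows "0 \<in> run_counts k \<Sigma>"
proof -
  have "k_abelian_singleton k \<Sigma> []"
    unfolding k_abelian_singleton_def k_abelian_equiv_def
  proof (intro conjI ballI impI)
    fix v assume eq: "\<forall>w. w \<noteq> [] \<and> length w \<le> k \<longrightarrow> occ w [] = occ w v"
    show "v = []"
    proof (cases v)
      case (Cons a v')
      have "occ [a] [] = occ [a] v" using eq assms by auto
      moreover have "occ [a] [] = 0" by (auto simp: occ_def occurs_at_def)
      moreover have "{i. occurs_at [a] v i} \<noteq> {}"
        using Cons by (auto simp: occurs_at_def intro!: exI[of _ 0])
      moreover have "finite {i. occurs_at [a] v i}"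
        by (rule finite_subset[of _ "{..length v}"]) (auto simp: occurs_at_def)
      ultimately show ?thesis by (auto simp: occ_def)
    qed auto
  qed auto
  moreover have "run_factorization k [] 0 (\<lambda>_. []) (\<lambda>_. 1) r q" for r :: "nat \<Rightarrow> 'a list" and q
    using assms by (auto simp: run_factorization_def t_pos_def occurs_at_def)
  ultimately show ?thesis unfolding run_counts_def by blast
qed

lemma finite_cycle_path_counts:
  assumes "finite (pverts G)"
  shows "finite (cycle_path_counts G)"
proof -
  have "s \<le> card (Pow (pverts G))" if "s \<in> cycle_path_counts G" for s
  proof -
    from that obtain C where C: "vertex_disjoint_cycles G C" "card C = s"
      unfolding cycle_path_counts_def by blast
    have cyc: "pre_digraph.cycle (with_proj G) c" if "c \<in> C" for c
      using C that by (auto simp: vertex_disjoint_cycles_def)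
    have sub: "cycle_verts c \<inter> pverts G \<noteq> {}" if "c \<in> C" for c
    proof -
      from cyc[OF that] obtain v where v: "pre_digraph.awalk (with_proj G) v c v" "c \<noteq> []"
        by (auto simp: pre_digraph.cycle_def)
      hence "v \<in> pverts G" "fst (hd c) = v"
        by (auto simp: pre_digraph.awalk_def pre_digraph.cas_simp)
      thus ?thesis using v by (auto simp: cycle_verts_def intro!: image_eqI[of _ _ "hd c"])
    qed
    have "inj_on (\<lambda>c. cycle_verts c \<inter> pverts G) C"
    proof (rule inj_onI, rule ccontr)
      fix c d assume cd: "c \<in> C" "d \<in> C" "cycle_verts c \<inter> pverts G = cycle_verts d \<inter> pverts G"
        "c \<noteq> d"
      hence "cycle_verts c \<inter> cycle_verts d = {}"
        using C by (auto simp: vertex_disjoint_cycles_def)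
      with cd sub show False by blast
    qed
    hence "card C \<le> card (Pow (pverts G))"
      using assms by (intro card_inj_on_le) auto
    thus ?thesis using C by simp
  qed
  thus ?thesis by (meson finite_nat_set_iff_bounded_le)
qed

lemma zero_in_cycle_path_counts:
  assumes "pverts G \<noteq> {}"
  shows "0 \<in> cycle_path_counts G"
proof -
  from assms obtain v where v: "v \<in> pverts G" by blast
  have "vwalk [{v}] (with_proj (quotient_graph G {}))"
    using v by (auto simp: vwalk_def quotient_graph_def quotient_verts_def free_verts_def)
  thus ?thesis unfolding cycle_path_counts_def
    by (intro CollectI exI[of _ "{}"] exI[of _ "[{v}]"]) (auto simp: vertex_disjoint_cycles_def)
qed

lemma de_bruijn_verts_finite_nonempty:
  assumes "finite \<Sigma>" "\<Sigma> \<noteq> {}"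
  shows "finite (pverts (de_bruijn \<Sigma> n))" "pverts (de_bruijn \<Sigma> n) \<noteq> {}"
proof -
  show "finite (pverts (de_bruijn \<Sigma> n))"
    using finite_words[OF assms(1), of n] by (simp add: de_bruijn_def)
  from assms obtain a where "a \<in> \<Sigma>" by blast
  hence "replicate n a \<in> pverts (de_bruijn \<Sigma> n)" by (auto simp: de_bruijn_def)
  thus "pverts (de_bruijn \<Sigma> n) \<noteq> {}" by blast
qed

end

theory Submission
  imports Defs
begin

text \<open>
  Put \<open>n = k - 1\<close>. Reading the factors of length \<open>n\<close> of a word \<open>u\<close> from left to right is a walk in
  the de Bruijn graph of order \<open>n\<close>. The cyclic factors of a \<open>k\<close>-full root \<open>r\<close> are pairwise distinct,
  so they are the vertices of a cycle of length \<open>|r|\<close>. In a run factorization these cycles are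
  vertex-disjoint, and while the walk reads the run it goes around the cycle of its root.

  The walk can be at a cycle only while it reads the corresponding run. A run is so long that each
  cyclic factor of its root occurs in it at least twice (\<open>outside_window_in_cycle_occ\<close>). A further
  occurrence outside all runs would make three, but a factor with an occurrence outside all runs
  occurs at most twice in \<open>u\<close>: such an occurrence is not covered by a run, so it overlaps the word
  between two neighbouring runs, or properly contains their overlap, and the factorization limits
  these factors (\<open>occ_outside_runs\<close>). An occurrence inside another run is excluded by disjointness.
  While a run is read, the walk is on a cycle, so the other vertices are visited only outside the
  runs and therefore at most twice.

  Hence the walk stays at each cycle for one interval of time and visits each other vertex at most
  twice. Collapsing the cycles and deleting immediate repetitions turns it into the required path of
  the quotient graph (\<open>collapsed_walk\<close>).
\<close>

section \<open>Collapsing a walk onto vertex-disjoint cycles\<close>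

text \<open>Deleting immediate repetitions keeps one entry of each maximal block of equal entries; the
  entry kept is counted here at the position where the block starts.\<close>

lemma count_remdups_adj:
  "count_list (remdups_adj xs) x =
     card {j. j < length xs \<and> xs ! j = x \<and> (j = 0 \<or> xs ! (j - 1) \<noteq> x)}"
proof (induction xs rule: rev_induct)
  case (snoc y xs)
  let ?S = "\<lambda>xs. {j. j < length xs \<and> xs ! j = x \<and> (j = 0 \<or> xs ! (j - 1) \<noteq> x)}"
  show ?case
  proof (cases xs rule: rev_cases)
    case Nil
    have "?S [y] = (if y = x then {0} else {})" by auto
    with Nil show ?thesis by simp
  next
    case (snoc zs z)
    have S: "?S (xs @ [y]) = ?S xs \<union> (if y = x \<and> z \<noteq> x then {length xs} else {})"
    proof (rule set_eqI)
      fix j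
      have last: "xs ! (length xs - 1) = z" "length xs > 0" using snoc by auto
      consider "j < length xs" | "j = length xs" | "j > length xs" by linarith
      thus "j \<in> ?S (xs @ [y]) \<longleftrightarrow>
          j \<in> ?S xs \<union> (if y = x \<and> z \<noteq> x then {length xs} else {})"
      proof cases
        case 1
        thus ?thesis by (auto simp: nth_append)
      next
        case 2
        have "(xs @ [y]) ! length xs = y" "(xs @ [y]) ! (length xs - 1) = z"
          using last by (auto simp: nth_append)
        with 2 last(2) show ?thesis by simp
      next
        case 3
        thus ?thesis by simp
      qed
    qed
    have "finite (?S xs)" "length xs \<notin> ?S xs" by auto
    hence "card (?S (xs @ [y])) = card (?S xs) + (if y = x \<and> z \<noteq> x then 1 else 0)"
      unfolding S by auto
    moreover have "count_list (remdups_adj (xs @ [y])) x =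
        count_list (remdups_adj xs) x + (if y = x \<and> z \<noteq> x then 1 else 0)"
      using snoc by (auto simp: remdups_adj_append_two)
    ultimately show ?thesis using snoc.IH by simp
  qed
qed simp

lemma successively_remdups_adj:
  assumes "successively (\<lambda>x y. x = y \<or> P x y) xs"
  shows "successively (\<lambda>x y. x \<noteq> y \<and> P x y) (remdups_adj xs)"
  using assms by (induction xs rule: remdups_adj.induct) (auto simp: successively_Cons)

lemma vwalk_arcs_subset_iff_successively:
  "set (vwalk_arcs p) \<subseteq> A \<longleftrightarrow> successively (\<lambda>x y. (x, y) \<in> A) p"
  by (induction p rule: vwalk_arcs.induct) auto

text \<open>The path of the quotient graph has one entry for each maximal stay of the walk in a class of
  \<open>V/C\<close>. So a cycle that is occupied during a single interval of time is traversed once, and the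
  loops and the arcs inside a class, which the quotient graph does not have, disappear.\<close>

lemma collapsed_walk:
  assumes C: "vertex_disjoint_cycles G C"
    and "N > 0"
    and verts: "\<And>j. j < N \<Longrightarrow> f j \<in> pverts G"
    and arcs: "\<And>j. Suc j < N \<Longrightarrow> (f j, f (Suc j)) \<in> parcs G"
    and interval: "\<And>c. c \<in> C \<Longrightarrow>
      \<exists>a b. a \<le> b \<and> b < N \<and> (\<forall>j<N. f j \<in> cycle_verts c \<longleftrightarrow> a \<le> j \<and> j \<le> b)"
    and twice: "\<And>v. v \<in> free_verts G C \<Longrightarrow> card {j. j < N \<and> f j = v} \<le> 2"
  shows "card C \<in> cycle_path_counts G"
proof -
  \<comment> \<open>The class of \<open>w\<close> in \<open>V/C\<close>; by disjointness the union has at most one member.\<close>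
  define h where "h w = insert w (\<Union>c\<in>{c\<in>C. w \<in> cycle_verts c}. cycle_verts c)" for w
  have h_cycle: "h w = cycle_verts c \<longleftrightarrow> w \<in> cycle_verts c" if "c \<in> C" for w c
  proof
    assume "w \<in> cycle_verts c"
    moreover from this have "{d\<in>C. w \<in> cycle_verts d} = {c}"
      using C \<open>c \<in> C\<close> unfolding vertex_disjoint_cycles_def by blast
    ultimately show "h w = cycle_verts c" unfolding h_def by auto
  qed (auto simp: h_def)
  have h_free: "h w = {w}" if "w \<in> free_verts G C" for w
    using that by (auto simp: h_def free_verts_def)
  have h_free_eq: "w = v" if "h w = {v}" for v w
    using that by (auto simp: h_def)
  have h_vert: "h w \<in> quotient_verts G C" if "w \<in> pverts G" for w
  proof (cases "w \<in> free_verts G C")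
    case True
    with h_free show ?thesis by (auto simp: quotient_verts_def)
  next
    case False
    with \<open>w \<in> pverts G\<close> obtain c where "c \<in> C" "w \<in> cycle_verts c"
      by (auto simp: free_verts_def)
    with h_cycle show ?thesis by (auto simp: quotient_verts_def)
  qed
  define xs where "xs = map (\<lambda>j. h (f j)) [0..<N]"
  have len: "length xs = N" and nth: "\<And>j. j < N \<Longrightarrow> xs ! j = h (f j)"
    by (auto simp: xs_def)
  have xs_verts: "set xs \<subseteq> quotient_verts G C"
    using verts h_vert by (auto simp: xs_def)
  have "successively (\<lambda>X Y. X = Y \<or> (X, Y) \<in> parcs (quotient_graph G C)) xs"
  proof -
    have "h (f j) = h (f (Suc j)) \<or> (h (f j), h (f (Suc j))) \<in> parcs (quotient_graph G C)"
      if "Suc j < N" for j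
    proof -
      have "f j \<in> h (f j)" "f (Suc j) \<in> h (f (Suc j))" by (auto simp: h_def)
      with arcs[OF that] verts[of j] verts[of "Suc j"] that h_vert show ?thesis
        by (auto simp: quotient_graph_def)
    qed
    thus ?thesis by (auto simp: successively_conv_nth len nth)
  qed
  hence "successively (\<lambda>X Y. (X, Y) \<in> parcs (quotient_graph G C)) (remdups_adj xs)"
    using successively_remdups_adj by (metis (mono_tags, lifting) successively_mono)
  hence "vwalk (remdups_adj xs) (with_proj (quotient_graph G C))"
    using xs_verts \<open>N > 0\<close> len
    by (auto simp: vwalk_def vwalk_arcs_subset_iff_successively quotient_graph_def)
  moreover have "count_list (remdups_adj xs) (cycle_verts c) = 1" if "c \<in> C" for c
  proof -
    obtain a b where ab: "a \<le> b" "b < N"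
      and iff: "\<And>j. j < N \<Longrightarrow> f j \<in> cycle_verts c \<longleftrightarrow> a \<le> j \<and> j \<le> b"
      using interval[OF \<open>c \<in> C\<close>] by blast
    have at: "xs ! j = cycle_verts c \<longleftrightarrow> a \<le> j \<and> j \<le> b" if "j < N" for j
      using that nth h_cycle[OF \<open>c \<in> C\<close>] iff by simp
    have "j < N \<and> xs ! j = cycle_verts c \<and> (j = 0 \<or> xs ! (j - 1) \<noteq> cycle_verts c) \<longleftrightarrow> j = a"
      for j
    proof (cases "j < N")
      case True
      hence "xs ! j = cycle_verts c \<longleftrightarrow> a \<le> j \<and> j \<le> b"
        "xs ! (j - 1) = cycle_verts c \<longleftrightarrow> a \<le> j - 1 \<and> j - 1 \<le> b"
        by (simp_all only: at less_imp_diff_less)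
      with True ab show ?thesis by presburger
    next
      case False
      with ab show ?thesis by linarith
    qed
    hence "{j. j < length xs \<and> xs ! j = cycle_verts c \<and> (j = 0 \<or> xs ! (j - 1) \<noteq> cycle_verts c)} = {a}"
      by (simp only: len singleton_conv)
    thus ?thesis by (simp add: count_remdups_adj)
  qed
  moreover have "count_list (remdups_adj xs) {v} \<le> 2" if "v \<in> free_verts G C" for v
  proof -
    have "f j = v" if "j < N" "xs ! j = {v}" for j
      using that nth h_free_eq by metis
    hence "{j. j < length xs \<and> xs ! j = {v} \<and> (j = 0 \<or> xs ! (j - 1) \<noteq> {v})}
        \<subseteq> {j. j < N \<and> f j = v}"
      unfolding len by blast
    hence "count_list (remdups_adj xs) {v} \<le> card {j. j < N \<and> f j = v}"
      unfolding count_remdups_adj by (intro card_mono) simp_all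
    with twice[OF that] show ?thesis by simp
  qed
  ultimately show ?thesis
    using C unfolding cycle_path_counts_def by blast
qed

section \<open>Windows of words and walks in the de Bruijn graph\<close>

text \<open>Finite words (with \<open>nth u\<close>) and the periodic words \<open>r\<^sup>\<omega>\<close> (with \<open>omega r\<close>) are both
  sequences of letters, so their factors can be treated together.\<close>

definition window :: "(nat \<Rightarrow> 'a) \<Rightarrow> nat \<Rightarrow> nat \<Rightarrow> 'a list" where
  "window f n i = map f [i..<i + n]"

lemma length_window [simp]: "length (window f n i) = n"
  by (simp add: window_def)

lemma window_eqI:
  assumes "\<And>m. m < n \<Longrightarrow> f (i + m) = g (j + m)"
  shows "window f n i = window g n j"
  using assms by (auto simp: window_def intro!: nth_equalityI)

lemma window_in_de_bruijn:
  assumes "\<And>m. i \<le> m \<Longrightarrow> m < i + n \<Longrightarrow> f m \<in> \<Sigma>"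
  shows "window f n i \<in> pverts (de_bruijn \<Sigma> n)"
  using assms by (auto simp: window_def de_bruijn_def)

lemma window_arc_in_de_bruijn:
  assumes "\<And>m. i \<le> m \<Longrightarrow> m \<le> i + n \<Longrightarrow> f m \<in> \<Sigma>" and "n > 0"
  shows "(window f n i, window f n (Suc i)) \<in> parcs (de_bruijn \<Sigma> n)"
proof -
  let ?x = "map f [Suc i..<i + n]"
  have "window f n i = f i # ?x" "window f n (Suc i) = ?x @ [f (i + n)]"
    using assms(2) by (simp_all add: window_def upt_conv_Cons)
  moreover have "f i \<in> \<Sigma>" "f (i + n) \<in> \<Sigma>" "?x \<in> lists \<Sigma>" "Suc (length ?x) = n"
    using assms by auto
  ultimately show ?thesis unfolding de_bruijn_def by auto
qed

lemma occurs_at_iff_window: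
  "occurs_at w u j \<longleftrightarrow> j + length w \<le> length u \<and> window (nth u) (length w) j = w"
proof -
  have "take (length w) (drop j u) = window (nth u) (length w) j" if "j + length w \<le> length u"
    using that by (auto simp: window_def intro!: nth_equalityI)
  thus ?thesis by (auto simp: occurs_at_def)
qed

lemma finite_occurrences: "finite {j. occurs_at w u j}"
  by (rule finite_subset[of _ "{..length u}"]) (auto simp: occurs_at_def)

lemma cyclic_factors_eq_windows:
  assumes "r \<noteq> []"
  shows "cyclic_factors n r = window (omega r) n ` {..<length r}"
proof -
  have "window (omega r) n i = window (omega r) n (i mod length r)" for i
    by (rule window_eqI) (simp add: omega_def mod_add_left_eq)
  moreover have "i mod length r < length r" for i using assms by simp
  ultimately show ?thesis
    unfolding cyclic_factors_def window_def[symmetric] by (auto simp: image_iff)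
qed

text \<open>Fullness says exactly that the walk along \<open>r\<^sup>\<omega>\<close> does not revisit a vertex before it closes.\<close>

lemma inj_on_windows_if_k_full:
  assumes "k_full k r"
  shows "inj_on (window (omega r) (k - 1)) {..<length r}"
proof (rule eq_card_imp_inj_on)
  show "card (window (omega r) (k - 1) ` {..<length r}) = card {..<length r}"
    using assms cyclic_factors_eq_windows[of r "k - 1"] by (simp add: k_full_def)
qed simp

lemma closed_walk_is_cycle:
  assumes "L > 0" "inj_on g {..<L}" "g L = g 0" "g 0 \<in> pverts G"
    and arcs: "\<And>i. i < L \<Longrightarrow> (g i, g (Suc i)) \<in> parcs G"
  defines "c \<equiv> map (\<lambda>i. (g i, g (Suc i))) [0..<L]"
  shows "pre_digraph.cycle (with_proj G) c"
proof -
  have cas: "pcas (g a) (map (\<lambda>i. (g i, g (Suc i))) [a..<a + d]) (g (a + d))" for a d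
  proof (induction d arbitrary: a)
    case (Suc d)
    have "[a..<a + Suc d] = a # [Suc a..<Suc a + d]" by (simp add: upt_conv_Cons)
    with Suc.IH[of "Suc a"] show ?case by simp
  qed simp
  have "pre_digraph.awalk (with_proj G) (g 0) c (g 0)"
    using cas[of 0 L] assms(3,4) arcs
    by (auto simp: pre_digraph.awalk_def cas_with_proj_eq c_def)
  moreover have "distinct (tl (pre_digraph.awalk_verts (with_proj G) (g 0) c))"
  proof -
    have "c \<noteq> []" using \<open>L > 0\<close> by (simp add: c_def)
    moreover have "map fst c = g 0 # map g [1..<L]"
      using \<open>L > 0\<close> by (simp add: c_def upt_conv_Cons)
    moreover have "snd (last c) = g 0"
      using assms by (simp add: c_def last_map)
    ultimately have "tl (pre_digraph.awalk_verts (with_proj G) (g 0) c) = map g [1..<L] @ [g 0]"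
      by (simp add: pre_digraph.awalk_verts_conv)
    moreover have "g 0 \<notin> g ` {1..<L}"
      using inj_onD[OF assms(2), of 0] \<open>L > 0\<close> by force
    moreover have "inj_on g {1..<L}"
      by (rule inj_on_subset[OF assms(2)]) auto
    ultimately show ?thesis by (simp add: distinct_map)
  qed
  moreover have "c \<noteq> []" using \<open>L > 0\<close> by (simp add: c_def)
  ultimately show ?thesis
    unfolding pre_digraph.cycle_def by blast
qed

lemma ex_cycle_of_k_full:
  assumes "k \<ge> 2" "k_full k r" "r \<in> lists \<Sigma>"
  obtains c where "pre_digraph.cycle (with_proj (de_bruijn \<Sigma> (k - 1))) c"
    and "cycle_verts c = cyclic_factors (k - 1) r"
proof -
  let ?g = "window (omega r) (k - 1)"
  have "r \<noteq> []" using assms(2) by (simp add: k_full_def)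
  hence letters: "omega r m \<in> \<Sigma>" for m
    using assms(3) by (auto simp: omega_def)
  have closed: "?g (length r) = ?g 0"
    by (rule window_eqI) (simp add: omega_def)
  show ?thesis
  proof (rule that)
    let ?c = "map (\<lambda>i. (?g i, ?g (Suc i))) [0..<length r]"
    show "pre_digraph.cycle (with_proj (de_bruijn \<Sigma> (k - 1))) ?c"
      using \<open>r \<noteq> []\<close> assms closed letters
      by (intro closed_walk_is_cycle inj_on_windows_if_k_full window_in_de_bruijn
          window_arc_in_de_bruijn) auto
    show "cycle_verts ?c = cyclic_factors (k - 1) r"
      using \<open>r \<noteq> []\<close> by (simp add: cyclic_factors_eq_windows cycle_verts_def image_image
          lessThan_atLeast0)
  qed
qed

section \<open>Long runs\<close>

lemma length_rpow_ge:
  assumes "r \<noteq> []" "q \<ge> 2 + of_nat n / of_nat (length r)"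
  shows "length (rpow r q) \<ge> 2 * length r + n"
proof -
  have "of_nat (2 * length r + n) = (2 + of_nat n / of_nat (length r)) * (of_nat (length r) :: rat)"
    using assms(1) by (simp add: field_simps)
  also have "\<dots> \<le> q * of_nat (length r)"
    using assms(2) by (rule mult_right_mono) simp
  finally have "int (2 * length r + n) \<le> \<lfloor>q * of_nat (length r)\<rfloor>"
    by (metis floor_mono floor_of_nat)
  thus ?thesis by (simp add: rpow_def)
qed

lemma window_in_power:
  assumes "occurs_at (rpow r q) u b" "b \<le> j" "j + n \<le> b + length (rpow r q)"
  shows "window (nth u) n j = window (omega r) n (j - b)"
proof (rule window_eqI)
  fix m assume "m < n"
  let ?i = "j + m - b"
  have i: "?i < length (rpow r q)" "j + m = b + ?i" using assms \<open>m < n\<close> by auto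
  have "u ! (b + ?i) = window (nth u) (length (rpow r q)) b ! ?i"
    using i by (simp add: window_def)
  also have "\<dots> = rpow r q ! ?i"
    using assms(1) by (simp add: occurs_at_iff_window)
  also have "\<dots> = omega r ?i" using i by (simp add: rpow_def)
  finally show "u ! (j + m) = omega r (j - b + m)" using i assms(2) by simp
qed

text \<open>The first two turns around the cycle already fit into the power and show each cyclic factor
  twice; an occurrence that is not inside the power is a third one.\<close>

lemma outside_window_in_cycle_occ:
  assumes "r \<noteq> []" "q \<ge> 2 + of_nat n / of_nat (length r)" "occurs_at (rpow r q) u b"
    and "j + n \<le> length u" "\<not> (b \<le> j \<and> j + n \<le> b + length (rpow r q))"
    and "window (nth u) n j \<in> cyclic_factors n r"
  shows "occ (window (nth u) n j) u \<ge> 3"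
proof -
  let ?w = "window (nth u) n j" and ?L = "length r"
  note long = length_rpow_ge[OF assms(1,2)]
  obtain i where i: "i < ?L" "?w = window (omega r) n i"
    using assms(6) cyclic_factors_eq_windows[OF assms(1)] by blast
  have "window (nth u) n (b + i) = ?w"
    using window_in_power[OF assms(3), of "b + i" n] i long by simp
  moreover have "window (nth u) n (b + (i + ?L)) = ?w"
  proof -
    have "window (omega r) n (i + ?L) = window (omega r) n i"
    proof (rule window_eqI)
      fix m
      have "(i + ?L + m) mod ?L = (i + m + ?L) mod ?L" by (simp add: ac_simps)
      thus "omega r (i + ?L + m) = omega r (i + m)" by (simp add: omega_def)
    qed
    with window_in_power[OF assms(3), of "b + (i + ?L)" n] i long show ?thesis by simp
  qed
  moreover have "b + length (rpow r q) \<le> length u"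
    using assms(3) by (simp add: occurs_at_def)
  ultimately have "{j, b + i, b + (i + ?L)} \<subseteq> {j. occurs_at ?w u j}"
    using assms(4) i long by (auto simp: occurs_at_iff_window)
  hence "card {j, b + i, b + (i + ?L)} \<le> occ ?w u"
    unfolding occ_def by (intro card_mono finite_occurrences)
  moreover have "j \<noteq> b + i" "j \<noteq> b + (i + ?L)" using assms(5) i long by auto
  ultimately show ?thesis using assms(1) by simp
qed

section \<open>Factors outside the runs\<close>

text \<open>Such an occurrence starts between the beginning of some run and that of the next one, and it
  reaches beyond the end of the former run. So it meets the gap between the two runs, or contains
  their overlap strictly inside. Before the first run, the beginning of \<open>u\<close> takes the place of the
  end of a run.\<close>

lemma occ_outside_runs:
  assumes rf: "run_factorization k u s t \<sigma> r q" and k: "k \<ge> 2" and j: "j + (k - 1) \<le> length u"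
    and out: "\<And>i. i \<in> {1..s} \<Longrightarrow> \<not> (next_start t \<sigma> r q (i - 1) \<le> j \<and>
      j + (k - 1) \<le> next_start t \<sigma> r q (i - 1) + length (rpow (r i) (q i)))"
  shows "occ (window (nth u) (k - 1) j) u \<le> 2"
proof -
  let ?B = "\<lambda>i. next_start t \<sigma> r q (i - 1)" and ?E = "run_end t \<sigma> r q"
  define P where "P i \<longleftrightarrow> i \<le> s \<and> (i = 0 \<or> ?B i \<le> j)" for i
  define i where "i = (GREATEST i. P i)"
  have "P i" and max: "\<And>i'. P i' \<Longrightarrow> i' \<le> i"
  proof -
    have "P 0" and bound: "\<And>i'. P i' \<Longrightarrow> i' \<le> s" by (auto simp: P_def)
    from GreatestI_nat[of P, OF this] Greatest_le_nat[of P _ s, OF _ bound]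
    show "P i" "\<And>i'. P i' \<Longrightarrow> i' \<le> i" unfolding i_def by blast+
  qed
  hence "i \<le> s" by (simp add: P_def)
  have E: "?E i < j + (k - 1)"
  proof (cases i)
    case 0
    with k show ?thesis by simp
  next
    case (Suc i')
    hence "i \<in> {1..s}" "?B i \<le> j" using \<open>P i\<close> by (auto simp: P_def)
    with out[of i] Suc show ?thesis by (simp add: next_start_def)
  qed
  have B: "j < next_start t \<sigma> r q i" if "i < s"
  proof -
    have "\<not> P (Suc i)" using max by fastforce
    with that show ?thesis by (simp add: P_def)
  qed
  have len: "length u = ?E s + length (t s)" and "\<sigma> s = 1"
    using rf by (auto simp: run_factorization_def)
  have "if \<sigma> i = 1 then overlapping j (k - 1) (t_pos t \<sigma> r q i) (length (t i))
         else strictly_inside j (k - 1) (t_pos t \<sigma> r q i) (length (t i))"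
  proof (cases "\<sigma> i = 1")
    case True
    have "j < ?E i + length (t i)"
    proof (cases "i = s")
      case True
      with len j k show ?thesis by simp
    next
      case False
      with \<open>i \<le> s\<close> B \<open>\<sigma> i = 1\<close> show ?thesis by (simp add: next_start_def next_pos_def)
    qed
    with True E show ?thesis by (simp add: overlapping_def t_pos_def)
  next
    case False
    with \<open>\<sigma> s = 1\<close> \<open>i \<le> s\<close> have "i < s" by (metis le_neq_implies_less)
    \<comment> \<open>The next run starts after \<open>j\<close>, hence not at 0, so the subtraction does not truncate.\<close>
    with False E B show ?thesis
      by (simp add: strictly_inside_def t_pos_def next_start_def next_pos_def)
  qed
  moreover have "occurs_at (window (nth u) (k - 1) j) u j"
    using j by (simp add: occurs_at_iff_window)
  moreover have "\<forall>i\<le>s. \<forall>j w. length w = k - 1 \<and> occurs_at w u j \<and>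
        (if \<sigma> i = 1 then overlapping j (k - 1) (t_pos t \<sigma> r q i) (length (t i))
         else strictly_inside j (k - 1) (t_pos t \<sigma> r q i) (length (t i)))
        \<longrightarrow> occ w u \<le> 2"
    using rf unfolding run_factorization_def by (elim conjE)
  ultimately show ?thesis
    using \<open>i \<le> s\<close> by (metis length_window)
qed

section \<open>The path given by a run factorization\<close>

lemma run_factorization_gives_cycle_path:
  assumes k: "k \<ge> 2" and u: "u \<in> lists \<Sigma>" and rf: "run_factorization k u s t \<sigma> r q"
    and "s > 0"
  shows "s \<in> cycle_path_counts (de_bruijn \<Sigma> (k - 1))"
proof -
  let ?n = "k - 1" and ?G = "de_bruijn \<Sigma> (k - 1)"
  let ?B = "\<lambda>i. next_start t \<sigma> r q (i - 1)" and ?V = "\<lambda>i. cyclic_factors (k - 1) (r i)"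
  let ?R = "\<lambda>i. length (rpow (r i) (q i))" and ?f = "window (nth u) (k - 1)"
  have run: "r i \<noteq> []" "q i \<ge> 2 + of_nat ?n / of_nat (length (r i))"
    "occurs_at (rpow (r i) (q i)) u (?B i)" "k_full k (r i)" "r i \<in> lists \<Sigma>"
    if "i \<in> {1..s}" for i
  proof -
    have kr: "k_full_run k u (?B i) (r i) (q i)"
      and "q i \<ge> 2 + of_nat ?n / of_nat (length (r i))"
      using rf that unfolding run_factorization_def by blast+
    thus "r i \<noteq> []" "q i \<ge> 2 + of_nat ?n / of_nat (length (r i))"
      "occurs_at (rpow (r i) (q i)) u (?B i)" "k_full k (r i)"
      by (auto simp: k_full_run_def is_run_def primitive_def k_full_repetition_def)
    show "r i \<in> lists \<Sigma>"
      by (rule root_in_lists[of _ "q i" u]) (use kr u in \<open>auto simp: k_full_run_def is_run_def\<close>)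
  qed
  have disjoint: "?V i \<inter> ?V i' = {}" if "i \<in> {1..s}" "i' \<in> {1..s}" "i \<noteq> i'" for i i'
    using rf that unfolding run_factorization_def by blast
  have fits: "?B i + ?R i \<le> length u" "2 * length (r i) + ?n \<le> ?R i" if "i \<in> {1..s}" for i
    using run(3)[OF that] length_rpow_ge[OF run(1,2)[OF that]] by (auto simp: occurs_at_def)
  have inside: "?f j \<in> ?V i"
    if "i \<in> {1..s}" "?B i \<le> j" "j + ?n \<le> ?B i + ?R i" for i j
    using window_in_power[OF run(3)[OF that(1)] that(2,3)]
    by (auto simp: cyclic_factors_def window_def)
  have in_cycle_iff: "?f j \<in> ?V i \<longleftrightarrow> ?B i \<le> j \<and> j + ?n \<le> ?B i + ?R i"
    if i: "i \<in> {1..s}" and j: "j + ?n \<le> length u" for i j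
  proof (rule iffI, rule ccontr)
    assume V: "?f j \<in> ?V i" and out: "\<not> (?B i \<le> j \<and> j + ?n \<le> ?B i + ?R i)"
    have "\<not> (?B i' \<le> j \<and> j + ?n \<le> ?B i' + ?R i')" if "i' \<in> {1..s}" for i'
      using inside[OF that] disjoint[OF i that] V out by blast
    hence "occ (?f j) u \<le> 2" by (rule occ_outside_runs[OF rf k j])
    with outside_window_in_cycle_occ[OF run(1-3)[OF i] j out V] show False by simp
  qed (use inside[OF i] in blast)

  have "\<forall>i\<in>{1..s}. \<exists>c. pre_digraph.cycle (with_proj ?G) c \<and> cycle_verts c = ?V i"
    using ex_cycle_of_k_full[OF k] run(4,5) by metis
  then obtain c where c: "\<And>i. i \<in> {1..s} \<Longrightarrow> pre_digraph.cycle (with_proj ?G) (c i)"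
    "\<And>i. i \<in> {1..s} \<Longrightarrow> cycle_verts (c i) = ?V i"
    by metis
  have "inj_on c {1..s}"
  proof (rule inj_onI, rule ccontr)
    fix i i' assume ii: "i \<in> {1..s}" "i' \<in> {1..s}" "c i = c i'" "i \<noteq> i'"
    hence "?V i = ?V i'" using c(2) by metis
    moreover have "?V i \<noteq> {}" by (auto simp: cyclic_factors_def)
    ultimately show False using disjoint[OF ii(1,2,4)] by simp
  qed
  hence card: "card (c ` {1..s}) = s" by (simp add: card_image)

  let ?N = "length u - ?n + 1"
  have "?n \<le> length u" using fits[of 1] \<open>s > 0\<close> by simp
  hence N: "j < ?N \<longleftrightarrow> j + ?n \<le> length u" for j by linarith
  have letters: "u ! m \<in> \<Sigma>" if "m < length u" for m using u that by auto
  have "card (c ` {1..s}) \<in> cycle_path_counts ?G"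
  proof (rule collapsed_walk[where N = ?N and f = ?f])
    show "vertex_disjoint_cycles ?G (c ` {1..s})"
      unfolding vertex_disjoint_cycles_def using c disjoint by fastforce
    show "?f j \<in> pverts ?G" if "j < ?N" for j
      by (intro window_in_de_bruijn letters) (use that N[of j] in linarith)
    show "(?f j, ?f (Suc j)) \<in> parcs ?G" if "Suc j < ?N" for j
      by (intro window_arc_in_de_bruijn letters) (use that N[of "Suc j"] k in linarith)+
    show "\<exists>a b. a \<le> b \<and> b < ?N \<and> (\<forall>j<?N. ?f j \<in> cycle_verts d \<longleftrightarrow> a \<le> j \<and> j \<le> b)"
      if "d \<in> c ` {1..s}" for d
    proof -
      from that obtain i where i: "i \<in> {1..s}" "d = c i" by blast
      let ?last = "?B i + ?R i - ?n"
      have last: "j + ?n \<le> ?B i + ?R i \<longleftrightarrow> j \<le> ?last" for j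
        using fits[OF i(1)] by linarith
      have "?f j \<in> cycle_verts d \<longleftrightarrow> ?B i \<le> j \<and> j \<le> ?last" if "j < ?N" for j
        using in_cycle_iff[OF i(1)] that unfolding N last i(2) c(2)[OF i(1)] by blast
      moreover have "?B i \<le> ?last" "?last < ?N"
        using fits[OF i(1)] by linarith+
      ultimately show ?thesis by (intro exI[of _ "?B i"] exI[of _ ?last] conjI allI impI)
    qed
    show "card {j. j < ?N \<and> ?f j = v} \<le> 2" if v: "v \<in> free_verts ?G (c ` {1..s})" for v
    proof (cases "{j. j < ?N \<and> ?f j = v} = {}")
      case True
      thus ?thesis by (simp only: card.empty)
    next
      case False
      then obtain j where j: "j + ?n \<le> length u" "?f j = v" using N by blast
      have "v \<notin> ?V i" if "i \<in> {1..s}" for i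
        using v c(2)[OF that] that by (auto simp: free_verts_def)
      hence "\<not> (?B i \<le> j \<and> j + ?n \<le> ?B i + ?R i)" if "i \<in> {1..s}" for i
        using inside[OF that] j that by blast
      hence "occ v u \<le> 2" using occ_outside_runs[OF rf k j(1)] j(2) by simp
      moreover have "{j. j < ?N \<and> ?f j = v} \<subseteq> {j. occurs_at v u j}"
        unfolding N by (auto simp: occurs_at_iff_window)
      hence "card {j. j < ?N \<and> ?f j = v} \<le> occ v u"
        unfolding occ_def by (intro card_mono finite_occurrences)
      ultimately show ?thesis by simp
    qed
  qed simp
  with card show ?thesis by simp
qed

theorem proposition6p5:
  fixes k :: nat and \<Sigma> :: "'a set"
  assumes "k \<ge> 2" and "finite \<Sigma>" and "\<Sigma> \<noteq> {}"
  shows "s_max k \<Sigma> \<le> Max (cycle_path_counts (de_bruijn \<Sigma> (k - 1)))"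
proof -
  let ?G = "de_bruijn \<Sigma> (k - 1)"
  note G = de_bruijn_verts_finite_nonempty[OF assms(2,3), of "k - 1"]
  have "s_max k \<Sigma> \<in> run_counts k \<Sigma>"
    unfolding s_max_def using finite_run_counts[OF assms(2)] zero_in_run_counts[OF assms(1)]
    by (intro Max_in) auto
  then obtain u t \<sigma> r q where "u \<in> lists \<Sigma>" "run_factorization k u (s_max k \<Sigma>) t \<sigma> r q"
    unfolding run_counts_def k_abelian_singleton_def by blast
  \<comment> \<open>With no runs, \<open>u\<close> may be too short to have a factor of length \<open>k - 1\<close>, and then there is no walk.\<close>
  hence "s_max k \<Sigma> \<in> cycle_path_counts ?G"
    using run_factorization_gives_cycle_path[OF assms(1)] zero_in_cycle_path_counts[OF G(2)]
    by (metis gr0I)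
  with finite_cycle_path_counts[OF G(1)] show ?thesis by (rule Max_ge)
qed

end
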